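(* Let $f:I\subset\mathbb{R}_+\to\mathbb{R}_+$ be differentiable on the interior $I^\circ$ of the interval $I$, let $a,b\in I$ with $a<b$, and let $f'\in L([a,b])$. Let $(\alpha,m)\in(0,1]^2$, assume $\left[0,\frac bm\right]\subset I$ and that $f'$ exists on $\left[0,\frac bm\right]$ (as a one-sided derivative at any endpoint of $I$ lying in this interval), and suppose that $|f'|$ is $(\alpha,m)$-logarithmically convex on $\left[0,\frac bm\right]$. Let $\mu_1,\mu_2,\tau_1,\tau_2>0$ with $\mu_1+\tau_1=1$ and $\mu_2+\tau_2=1$. Put $\eta=|f'(a)|\,/\,\left|f'\left(\frac bm\right)\right|^m$. Then: if $\eta=1$, $$\left|\frac{f(a)+f(b)}{2}-\frac1{b-a}\int_a^b f(x)\,dx\right|\le \frac{b-a}{2}\left|f'\left(\tfrac bm\right)\right|^m\left[\frac{2\mu_1^3}{(2\mu_1+1)(\mu_1+1)}+\frac{2\mu_2^3}{(2\mu_2+1)(\mu_2+1)}+\tau_1+\tau_2\right];$$ if $\eta<1$, $$\left|\frac{f(a)+f(b)}{2}-\frac1{b-a}\int_a^b f(x)\,dx\right|\le \frac{b-a}{2}\left|f'\left(\tfrac bm\right)\right|^m\left\{\frac{2\mu_1^3}{(2\mu_1+1)(\mu_1+1)}+\frac{2\mu_2^3}{(2\mu_2+1)(\mu_2+1)}+\tau_1\frac{\eta^{\alpha/\tau_1}-1}{\ln(\eta^{\alpha/\tau_1})}+\tau_2\frac{\eta^{\alpha/\tau_2}-1}{\ln(\eta^{\alpha/\tau_2})}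\right\}.$$
   Context: $\mathbb{R}_+=[0,\infty)$. For $(\alpha,m)\in(0,1]\times(0,1]$ and $c>0$, a function $g:[0,c]\to(0,\infty)$ is $(\alpha,m)$-logarithmically convex on $[0,c]$ if $g(tx+m(1-t)y)\le [g(x)]^{t^\alpha}[g(y)]^{m(1-t^\alpha)}$ for all $x,y\in[0,c]$ and $t\in[0,1]$. In particular such a function is strictly positive. $L([a,b])$ denotes the (Lebesgue) integrable functions on $[a,b]$. *)

theory Defs
  imports "HOL-Analysis.Analysis"
begin

text \<open>A function \<open>g : [0, c] \<rightarrow> (0, \<infinity>)\<close> is represented by a total function on the reals of which
  only the values on \<open>{0..c}\<close> matter. Since \<open>g\<close> is positive there, \<open>powr\<close> is the usual real
  power; for \<open>t = 0\<close> the convention \<open>0 powr \<alpha> = 0\<close> is the correct value, as \<open>\<alpha> > 0\<close> in all uses.\<close>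

definition alpha_m_log_convex_on :: "real \<Rightarrow> real \<Rightarrow> real \<Rightarrow> (real \<Rightarrow> real) \<Rightarrow> bool" where
  "alpha_m_log_convex_on \<alpha> m c g \<longleftrightarrow>
     (\<forall>x\<in>{0..c}. g x > 0) \<and>
     (\<forall>x\<in>{0..c}. \<forall>y\<in>{0..c}. \<forall>t\<in>{0..1}.
        g (t * x + m * (1 - t) * y)
          \<le> g x powr (t powr \<alpha>) * g y powr (m * (1 - t powr \<alpha>)))"

end

theory Submission
  imports Defs
begin

text \<open>
  Integration by parts gives
  \<open>(b - a) * ((f a + f b) / 2) - \<integral> f = \<integral> (x - (a + b) / 2) * f' x\<close> over \<open>[a, b]\<close>.
  Convexity, applied at \<open>a\<close> and \<open>b / m\<close>, together with \<open>t powr \<alpha> \<ge> \<alpha> * t\<close> bounds \<open>\<bar>f' x\<bar>\<close> by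
  \<open>\<bar>f' (b / m)\<bar> powr m * (\<eta> powr \<alpha>) powr t\<close>, where \<open>x = t * a + (1 - t) * b\<close>. It remains to
  estimate \<open>\<integral> \<bar>1/2 - t\<bar> * \<theta> powr t\<close> over \<open>[0, 1]\<close>, once for each pair \<open>(\<mu>, \<tau>)\<close>. Young's
  inequality does this with the constant \<open>(1/2) powr p / (p + 1)\<close>, \<open>p = 1 / \<mu>\<close>, which is at most
  the constant \<open>2 / ((p + 1) * (p + 2))\<close> of the theorem.
\<close>

text \<open>The function \<open>F\<close> below has derivative
  \<open>f x + (x - (a + b) / 2) * f' x\<close>. The fundamental theorem for the gauge integral
  gives both the existence and the value of the integral of this derivative, and subtracting the
  integral of the continuous \<open>f\<close> leaves the claim.\<close>

lemma trapezoid_has_integral: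
  fixes f f' :: "real \<Rightarrow> real"
  assumes "a \<le> b"
    and f': "\<And>x. x \<in> {a..b} \<Longrightarrow> (f has_real_derivative f' x) (at x within {a..b})"
  shows "((\<lambda>x. (x - (a + b) / 2) * f' x) has_integral
           ((b - a) * ((f a + f b) / 2) - integral {a..b} f)) {a..b}"
proof -
  define F where "F = (\<lambda>x. (x - (a + b) / 2) * f x)"
  have "continuous_on {a..b} f"
    using f' by (rule DERIV_continuous_on)
  then have f: "(f has_integral integral {a..b} f) {a..b}"
    by (intro integrable_integral integrable_continuous_real)
  have "((\<lambda>x. f x + (x - (a + b) / 2) * f' x) has_integral (F b - F a)) {a..b}"
  proof (rule fundamental_theorem_of_calculus[OF \<open>a \<le> b\<close>])
    fix x assume "x \<in> {a..b}"
    then show "(F has_vector_derivative (f x + (x - (a + b) / 2) * f' x)) (at x within {a..b})"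
      unfolding F_def has_real_derivative_iff_has_vector_derivative[symmetric]
      by (auto intro!: derivative_eq_intros f')
  qed
  moreover have "F b - F a = (b - a) * ((f a + f b) / 2)"
    by (simp add: F_def field_simps)
  ultimately show ?thesis
    using has_integral_diff[OF _ f] by fastforce
qed

text \<open>After the shift by 1/2 the integrand is even on the symmetric interval, so the value is
  twice the integral of \<open>t powr p\<close> over the right half.\<close>

lemma has_integral_abs_half_minus_powr:
  fixes p :: real
  assumes "p > 0"
  shows "((\<lambda>t. \<bar>1/2 - t\<bar> powr p) has_integral ((1/2) powr p / (p + 1))) {0..1}"
proof -
  let ?i = "(1/2) powr (p + 1) / (p + 1)"
  have "((\<lambda>t. t powr p) has_integral ?i) {0..1/2}"
    using has_integral_powr_from_0[of p "1/2"] assms by simp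
  then have pos: "((\<lambda>t. \<bar>t\<bar> powr p) has_integral ?i) {0..1/2}"
    by (rule has_integral_eq[rotated]) auto
  have neg: "((\<lambda>t. \<bar>t\<bar> powr p) has_integral ?i) {-(1/2)..0}"
    using has_integral_reflect_real[THEN iffD2, OF pos] by simp
  have "((\<lambda>t. \<bar>t\<bar> powr p) has_integral (?i + ?i)) (cbox (-(1/2)) (1/2))"
    using has_integral_combine[OF _ _ neg pos] by simp
  from has_integral_affinity'[OF this, of 1 "-(1/2)"]
  have "((\<lambda>t. \<bar>t - 1/2\<bar> powr p) has_integral (?i + ?i)) {0..1}"
    by simp
  moreover have "?i + ?i = (1/2) powr p / (p + 1)"
    using assms by (simp add: powr_add divide_simps)
  ultimately show ?thesis
    by (simp add: abs_minus_commute)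
qed

lemma has_integral_powr_base:
  fixes c :: real
  assumes "c > 0" "c \<noteq> 1"
  shows "((\<lambda>t. c powr t) has_integral ((c - 1) / ln c)) {0..1}"
proof -
  have "((\<lambda>t. c powr t) has_integral (c powr 1 / ln c - c powr 0 / ln c)) {0..1}"
  proof (rule fundamental_theorem_of_calculus)
    fix t :: real
    show "((\<lambda>t. c powr t / ln c) has_vector_derivative c powr t) (at t within {0..1})"
      unfolding has_real_derivative_iff_has_vector_derivative[symmetric] powr_def
      using assms by (auto intro!: derivative_eq_intros)
  qed simp
  then show ?thesis
    using assms by (simp add: diff_divide_distrib)
qed

text \<open>Tangent line bound: \<open>2 powr p = exp (p * ln 2)\<close> is at least
  \<open>1 + p * ln 2\<close>, and ln 2 is at least 1/2.\<close>

lemma add_two_le_two_powr: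
  fixes p :: real
  assumes "p \<ge> 0"
  shows "p + 2 \<le> 2 * 2 powr p"
proof -
  have "p * (1/2) \<le> p * ln 2"
    using ln2_ge_two_thirds assms by (intro mult_left_mono) auto
  moreover have "1 + p * ln 2 \<le> 2 powr p"
    using exp_ge_add_one_self[of "p * ln 2"] by (simp add: powr_def)
  ultimately show ?thesis by simp
qed

text \<open>Replaces the constant that Young's inequality produces by the rational one of the
  theorem. With \<open>p = 1 / \<mu>\<close> the previous lemma reads
  \<open>(1/2) powr p \<le> 2 / (p + 2)\<close>; clearing the fractions in \<mu> then accounts for
  the cube.\<close>

lemma half_powr_const_le:
  fixes \<mu> :: real
  assumes "\<mu> > 0"
  shows "\<mu> * ((1/2) powr (1/\<mu>) / (1/\<mu> + 1)) \<le> 2 * \<mu> ^ 3 / ((2 * \<mu> + 1) * (\<mu> + 1))"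
proof -
  define p where "p = 1 / \<mu>"
  have p: "p > 0" and \<mu>: "\<mu> = 1 / p"
    using assms by (auto simp: p_def)
  have "(1/2) powr p \<le> 2 / (p + 2)"
    using add_two_le_two_powr[of p] p by (simp add: powr_divide field_simps)
  then have "\<mu> * ((1/2) powr p / (p + 1)) \<le> \<mu> * (2 / (p + 2) / (p + 1))"
    using assms p by (intro mult_left_mono divide_right_mono) auto
  also have "\<dots> = 2 * \<mu> ^ 3 / ((2 * \<mu> + 1) * (\<mu> + 1))"
    using assms unfolding p_def by (simp add: divide_simps power3_eq_cube) (simp add: algebra_simps)
  finally show ?thesis by (simp add: p_def)
qed

text \<open>Young's inequality applies pointwise with the exponents \<open>1 / \<mu>\<close> and
  \<open>1 / \<tau>\<close>, conjugate because \<open>\<mu> + \<tau> = 1\<close>. The value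
  \<open>J\<close> is left abstract because its closed form depends on whether \<theta> equals
  1.\<close>

lemma integral_abs_half_minus_mult_powr_le:
  fixes \<theta> \<mu> \<tau> k J :: real
  assumes "\<theta> > 0" "\<mu> > 0" "\<tau> > 0" "\<mu> + \<tau> = 1"
    and k: "((\<lambda>t. \<bar>1/2 - t\<bar> * \<theta> powr t) has_integral k) {0..1}"
    and J: "((\<lambda>t. (\<theta> powr (1 / \<tau>)) powr t) has_integral J) {0..1}"
  shows "k \<le> 2 * \<mu> ^ 3 / ((2 * \<mu> + 1) * (\<mu> + 1)) + \<tau> * J"
proof -
  have "((\<lambda>t. \<mu> * \<bar>1/2 - t\<bar> powr (1/\<mu>) + \<tau> * (\<theta> powr (1/\<tau>)) powr t) has_integral
           (\<mu> * ((1/2) powr (1/\<mu>) / (1/\<mu> + 1)) + \<tau> * J)) {0..1}"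
    using assms by (intro has_integral_add has_integral_mult_right
        has_integral_abs_half_minus_powr J) auto
  then have "k \<le> \<mu> * ((1/2) powr (1/\<mu>) / (1/\<mu> + 1)) + \<tau> * J"
  proof (rule has_integral_le[OF k])
    fix t :: real
    have "\<bar>1/2 - t\<bar> * \<theta> powr t \<le> \<bar>1/2 - t\<bar> powr (1/\<mu>) / (1/\<mu>) + (\<theta> powr t) powr (1/\<tau>) / (1/\<tau>)"
      using assms by (intro Youngs_inequality) auto
    then show "\<bar>1/2 - t\<bar> * \<theta> powr t
        \<le> \<mu> * \<bar>1/2 - t\<bar> powr (1/\<mu>) + \<tau> * (\<theta> powr (1/\<tau>)) powr t"
      by (simp add: powr_powr mult.commute)
  qed
  with half_powr_const_le[OF \<open>\<mu> > 0\<close>] show ?thesis by simp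
qed

text \<open>This is the substitution \<open>t = (b - x) / (b - a)\<close>, inverse to
  \<open>x = t * a + (1 - t) * b\<close>. It reverses orientation, so it is composed of a scaling by
  the positive factor \<open>?c\<close> and the reflection of \<open>x\<close> to
  \<open>-x\<close>.\<close>

lemma has_integral_unit_interval_reflect:
  fixes g :: "real \<Rightarrow> real"
  assumes g: "(g has_integral k) {0..1}" and "a < b"
  shows "((\<lambda>x. g ((b - x) / (b - a))) has_integral ((b - a) * k)) {a..b}"
proof -
  let ?c = "1 / (b - a)"
  \<comment> \<open>These are the preimages of 0 and 1 under the map sending \<open>x\<close> to
    \<open>?c * x + b * ?c\<close>.\<close>
  have "(0 - b * ?c) /\<^sub>R ?c = -b" "(1 - b * ?c) /\<^sub>R ?c = -a"
    using \<open>a < b\<close> by (simp_all add: right_diff_distrib)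
  then have "((\<lambda>x. g (?c * x + b * ?c)) has_integral ((b - a) * k)) {-b..-a}"
    using has_integral_affinity'[of g k 0 1 ?c "b * ?c"] assms by simp
  then have "((\<lambda>x. g (?c * (- x) + b * ?c)) has_integral ((b - a) * k)) {a..b}"
    using has_integral_reflect_real[of "\<lambda>x. g (?c * x + b * ?c)" "(b - a) * k" "-a" "-b"] by simp
  moreover have "?c * (- x) + b * ?c = (b - x) / (b - a)" for x
    by (simp add: diff_divide_distrib)
  ultimately show ?thesis by simp
qed

lemma alpha_m_log_convex_on_bound:
  fixes g :: "real \<Rightarrow> real"
  assumes conv: "alpha_m_log_convex_on \<alpha> m (b / m) g"
    and "0 < \<alpha>" "\<alpha> \<le> 1" "0 < m" "m \<le> 1" "0 \<le> a" "a \<le> b" "t \<in> {0..1}"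
    and \<eta>: "\<eta> = g a / g (b / m) powr m" and "\<eta> \<le> 1"
  shows "g (t * a + (1 - t) * b) \<le> g (b / m) powr m * (\<eta> powr \<alpha>) powr t"
proof -
  have "b \<le> b / m"
    using assms by (simp add: field_simps mult_left_le)
  with assms have mem: "a \<in> {0..b / m}" "b / m \<in> {0..b / m}"
    by auto
  then have pos: "g a > 0" "g (b / m) > 0"
    using conv unfolding alpha_m_log_convex_on_def by auto
  then have "\<eta> > 0"
    by (simp add: \<eta>)
  \<comment> \<open>The chain is \<open>\<alpha> * t \<le> t \<le> t powr \<alpha>\<close>, valid
    since both \<alpha> and \<open>t\<close> are at most 1. It makes the exponent of \<eta> linear
    in \<open>t\<close>.\<close>
  have "\<alpha> * t \<le> t powr \<alpha>"
  proof -
    have "\<alpha> * t \<le> 1 * t" using assms by (intro mult_right_mono) auto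
    also have "1 * t \<le> t powr \<alpha>" using powr_mono'[of \<alpha> 1 t] assms by auto
    finally show ?thesis .
  qed
  \<comment> \<open>Writing \<open>b\<close> as \<open>m * (b / m)\<close> brings the argument into
    the shape demanded by the convexity condition at the points \<open>a\<close> and
    \<open>b / m\<close>.\<close>
  have "g (t * a + (1 - t) * b) = g (t * a + m * (1 - t) * (b / m))"
    using \<open>0 < m\<close> by simp
  also have "\<dots> \<le> g a powr (t powr \<alpha>) * g (b / m) powr (m * (1 - t powr \<alpha>))"
    using conv mem \<open>t \<in> {0..1}\<close> unfolding alpha_m_log_convex_on_def by blast
  also have "\<dots> = g (b / m) powr m * \<eta> powr (t powr \<alpha>)"
    using pos by (simp add: \<eta> powr_divide powr_powr right_diff_distrib powr_diff)
  \<comment> \<open>Since \<open>\<eta> \<le> 1\<close>, a smaller exponent gives a larger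
    power.\<close>
  also have "\<dots> \<le> g (b / m) powr m * \<eta> powr (\<alpha> * t)"
    using \<open>\<alpha> * t \<le> t powr \<alpha>\<close> \<open>\<eta> > 0\<close> \<open>\<eta> \<le> 1\<close> by (intro mult_left_mono powr_mono') auto
  finally show ?thesis
    by (simp add: powr_powr)
qed

text \<open>Common core of both cases of the theorem, to be used with
  \<open>\<theta> = \<eta> powr \<alpha>\<close> and
  \<open>M = \<bar>f' (b / m)\<bar> powr m\<close>. The cases then differ only in the values of
  \<open>J\<^sub>1\<close> and \<open>J\<^sub>2\<close>.\<close>

lemma trapezoid_error_le:
  fixes f f' :: "real \<Rightarrow> real"
  assumes "a < b" "\<theta> > 0"
    and f': "\<And>x. x \<in> {a..b} \<Longrightarrow> (f has_real_derivative f' x) (at x within {a..b})"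
    and bound: "\<And>t. t \<in> {0..1} \<Longrightarrow> \<bar>f' (t * a + (1 - t) * b)\<bar> \<le> M * \<theta> powr t"
    and \<mu>: "\<mu>\<^sub>1 > 0" "\<tau>\<^sub>1 > 0" "\<mu>\<^sub>1 + \<tau>\<^sub>1 = 1" "\<mu>\<^sub>2 > 0" "\<tau>\<^sub>2 > 0" "\<mu>\<^sub>2 + \<tau>\<^sub>2 = 1"
    and J\<^sub>1: "((\<lambda>t. (\<theta> powr (1 / \<tau>\<^sub>1)) powr t) has_integral J\<^sub>1) {0..1}"
    and J\<^sub>2: "((\<lambda>t. (\<theta> powr (1 / \<tau>\<^sub>2)) powr t) has_integral J\<^sub>2) {0..1}"
  shows "\<bar>(f a + f b) / 2 - 1 / (b - a) * integral {a..b} f\<bar>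
        \<le> (b - a) / 2 * M *
          (2 * \<mu>\<^sub>1 ^ 3 / ((2 * \<mu>\<^sub>1 + 1) * (\<mu>\<^sub>1 + 1))
           + 2 * \<mu>\<^sub>2 ^ 3 / ((2 * \<mu>\<^sub>2 + 1) * (\<mu>\<^sub>2 + 1)) + \<tau>\<^sub>1 * J\<^sub>1 + \<tau>\<^sub>2 * J\<^sub>2)"
proof -
  define E where "E = (b - a) * ((f a + f b) / 2) - integral {a..b} f"
  define h where "h = (\<lambda>t. \<bar>1/2 - t\<bar> * \<theta> powr t)"
  define k where "k = integral {0..1} h"
  have "continuous_on {0..1} h"
    unfolding h_def using \<open>\<theta> > 0\<close> by (intro continuous_intros) auto
  then have k: "(h has_integral k) {0..1}"
    unfolding k_def by (intro integrable_integral integrable_continuous_real)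
  \<comment> \<open>The factor \<open>b - a\<close> comes from
    \<open>x - (a + b) / 2 = (b - a) * (1/2 - t)\<close>; the change of variables contributes a
    second one to the integral.\<close>
  let ?B = "\<lambda>x. (b - a) * M * h ((b - x) / (b - a))"
  have I: "(?B has_integral ((b - a) * M * ((b - a) * k))) {a..b}"
    using has_integral_unit_interval_reflect[OF k \<open>a < b\<close>] by (rule has_integral_mult_right)
  have E: "((\<lambda>x. (x - (a + b) / 2) * f' x) has_integral E) {a..b}"
    unfolding E_def using \<open>a < b\<close> f' by (intro trapezoid_has_integral) auto
  have le: "\<bar>(x - (a + b) / 2) * f' x\<bar> \<le> ?B x" if "x \<in> {a..b}" for x
  proof -
    define t where "t = (b - x) / (b - a)"
    have t: "t \<in> {0..1}"
      using that \<open>a < b\<close> by (auto simp: t_def field_simps)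
    have "t * (b - a) = b - x"
      using \<open>a < b\<close> by (simp add: t_def)
    then have x: "x = t * a + (1 - t) * b"
      by (simp add: algebra_simps)
    have "x - (a + b) / 2 = (b - a) * (1/2 - t)"
      by (simp add: x field_simps)
    then have "\<bar>(x - (a + b) / 2) * f' x\<bar> = (b - a) * \<bar>1/2 - t\<bar> * \<bar>f' x\<bar>"
      using \<open>a < b\<close> by (simp add: abs_mult)
    also have "\<dots> \<le> (b - a) * \<bar>1/2 - t\<bar> * (M * \<theta> powr t)"
      using bound[OF t] \<open>a < b\<close> unfolding x[symmetric] by (intro mult_left_mono) auto
    finally show ?thesis
      by (simp add: h_def t_def mult_ac)
  qed
  \<comment> \<open>The majorant \<open>?B\<close> is compared with the integrand and with its
    negative, bounding both \<open>E\<close> and \<open>-E\<close>.\<close>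
  have "\<bar>E\<bar> \<le> (b - a) * M * ((b - a) * k)"
    using has_integral_le[OF E I] has_integral_le[OF has_integral_neg[OF E] I] le
    by (simp add: abs_le_iff)
  have "M \<ge> 0"
    using bound[of 0] \<open>\<theta> > 0\<close> by auto
  \<comment> \<open>The single integral \<open>k\<close> is estimated twice, once with each pair,
    and the two bounds are added. This is the origin of the factor \<open>(b - a) / 2\<close> and of
    the sum over both pairs.\<close>
  have "2 * k \<le> 2 * \<mu>\<^sub>1 ^ 3 / ((2 * \<mu>\<^sub>1 + 1) * (\<mu>\<^sub>1 + 1)) 
          + 2 * \<mu>\<^sub>2 ^ 3 / ((2 * \<mu>\<^sub>2 + 1) * (\<mu>\<^sub>2 + 1)) + \<tau>\<^sub>1 * J\<^sub>1 + \<tau>\<^sub>2 * J\<^sub>2" (is "_ \<le> ?S")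
    using integral_abs_half_minus_mult_powr_le[OF \<open>\<theta> > 0\<close> _ _ _ k[unfolded h_def] J\<^sub>1, of \<mu>\<^sub>1]
      integral_abs_half_minus_mult_powr_le[OF \<open>\<theta> > 0\<close> _ _ _ k[unfolded h_def] J\<^sub>2, of \<mu>\<^sub>2] \<mu>
    by simp
  have "E / (b - a) = (f a + f b) / 2 - 1 / (b - a) * integral {a..b} f"
    using \<open>a < b\<close> unfolding E_def by (subst diff_divide_distrib, subst nonzero_mult_div_cancel_left) auto
  then have "\<bar>(f a + f b) / 2 - 1 / (b - a) * integral {a..b} f\<bar> = \<bar>E / (b - a)\<bar>"
    by simp
  also have "\<dots> = \<bar>E\<bar> / (b - a)"
    using \<open>a < b\<close> by (simp add: abs_divide)
  also have "\<dots> \<le> (b - a) * M * ((b - a) * k) / (b - a)"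
    using \<open>\<bar>E\<bar> \<le> _\<close> \<open>a < b\<close> by (intro divide_right_mono) auto
  also have "\<dots> = (b - a) / 2 * M * (2 * k)"
    using \<open>a < b\<close> by simp
  also have "\<dots> \<le> (b - a) / 2 * M * ?S"
    using \<open>2 * k \<le> ?S\<close> \<open>a < b\<close> \<open>M \<ge> 0\<close> by (intro mult_left_mono) auto
  finally show ?thesis .
qed

theorem theorem4:
  fixes I :: "real set" and f f' :: "real \<Rightarrow> real"
    and a b \<alpha> m \<mu>\<^sub>1 \<mu>\<^sub>2 \<tau>\<^sub>1 \<tau>\<^sub>2 \<eta> :: real
  assumes "is_interval I" and "I \<subseteq> {0..}"
    and "\<And>x. x \<in> I \<Longrightarrow> f x \<ge> 0"
    and "\<And>x. x \<in> interior I \<Longrightarrow> (f has_real_derivative f' x) (at x)"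
    and "a \<in> I" and "b \<in> I" and "a < b"
    and "f' absolutely_integrable_on {a..b}"
    and "0 < \<alpha>" and "\<alpha> \<le> 1" and "0 < m" and "m \<le> 1"
    and "{0..b / m} \<subseteq> I"
    and "\<And>x. x \<in> {0..b / m} \<Longrightarrow> (f has_real_derivative f' x) (at x within I)"
    and "alpha_m_log_convex_on \<alpha> m (b / m) (\<lambda>x. \<bar>f' x\<bar>)"
    and "\<mu>\<^sub>1 > 0" and "\<mu>\<^sub>2 > 0" and "\<tau>\<^sub>1 > 0" and "\<tau>\<^sub>2 > 0"
    and "\<mu>\<^sub>1 + \<tau>\<^sub>1 = 1" and "\<mu>\<^sub>2 + \<tau>\<^sub>2 = 1"
    and "\<eta> = \<bar>f' a\<bar> / \<bar>f' (b / m)\<bar> powr m"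
  shows "(\<eta> = 1 \<longrightarrow>
      \<bar>(f a + f b) / 2 - 1 / (b - a) * integral {a..b} f\<bar>
        \<le> (b - a) / 2 * \<bar>f' (b / m)\<bar> powr m *
          (2 * \<mu>\<^sub>1 ^ 3 / ((2 * \<mu>\<^sub>1 + 1) * (\<mu>\<^sub>1 + 1))
           + 2 * \<mu>\<^sub>2 ^ 3 / ((2 * \<mu>\<^sub>2 + 1) * (\<mu>\<^sub>2 + 1))
           + \<tau>\<^sub>1 + \<tau>\<^sub>2))
    \<and> (\<eta> < 1 \<longrightarrow>
      \<bar>(f a + f b) / 2 - 1 / (b - a) * integral {a..b} f\<bar>
        \<le> (b - a) / 2 * \<bar>f' (b / m)\<bar> powr m *
          (2 * \<mu>\<^sub>1 ^ 3 / ((2 * \<mu>\<^sub>1 + 1) * (\<mu>\<^sub>1 + 1))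
           + 2 * \<mu>\<^sub>2 ^ 3 / ((2 * \<mu>\<^sub>2 + 1) * (\<mu>\<^sub>2 + 1))
           + \<tau>\<^sub>1 * ((\<eta> powr (\<alpha> / \<tau>\<^sub>1) - 1) / ln (\<eta> powr (\<alpha> / \<tau>\<^sub>1)))
           + \<tau>\<^sub>2 * ((\<eta> powr (\<alpha> / \<tau>\<^sub>2) - 1) / ln (\<eta> powr (\<alpha> / \<tau>\<^sub>2)))))"
proof -
  have "a \<ge> 0"
    using assms(2) \<open>a \<in> I\<close> by auto
  have "b \<le> b / m"
    using \<open>0 \<le> a\<close> \<open>a < b\<close> \<open>0 < m\<close> \<open>m \<le> 1\<close> by (simp add: field_simps mult_left_le)
  have sub: "{a..b} \<subseteq> {0..b / m}"
    using \<open>a \<ge> 0\<close> \<open>b \<le> b / m\<close> by auto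
  \<comment> \<open>Differentiability within \<open>I\<close> restricts to the subset
    \<open>{a..b}\<close>, so one-sided derivatives at endpoints of \<open>I\<close> are
    covered.\<close>
  have f': "(f has_real_derivative f' x) (at x within {a..b})" if "x \<in> {a..b}" for x
    using assms(13,14) sub that by (meson DERIV_subset subsetD subset_trans)
  have "f' a \<noteq> 0" "f' (b / m) \<noteq> 0"
    using assms(15) sub \<open>a < b\<close> \<open>b \<le> b / m\<close> \<open>a \<ge> 0\<close> unfolding alpha_m_log_convex_on_def
    by (force dest: bspec[of _ _ a] bspec[of _ _ "b / m"])+
  then have "\<eta> > 0"
    by (simp add: assms(22))
  have bound: "\<bar>f' (t * a + (1 - t) * b)\<bar> \<le> \<bar>f' (b / m)\<bar> powr m * (\<eta> powr \<alpha>) powr t"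
    if "t \<in> {0..1}" "\<eta> \<le> 1" for t
    using alpha_m_log_convex_on_bound[OF assms(15)] that assms(9-12,22) \<open>a \<ge> 0\<close> \<open>a < b\<close> by simp
  note est = trapezoid_error_le[OF \<open>a < b\<close> _ f' bound assms(16,18,20,17,19,21)]
  show ?thesis
  proof (intro conjI impI)
    assume "\<eta> = 1"
    \<comment> \<open>For \<open>\<eta> = 1\<close> the integrand is constantly 1.\<close>
    have J: "((\<lambda>t. ((\<eta> powr \<alpha>) powr (1 / \<tau>)) powr t) has_integral 1) {0..1}" for \<tau>
      using has_integral_const_real[of "1::real" 0 1] \<open>\<eta> = 1\<close> by simp
    show "\<bar>(f a + f b) / 2 - 1 / (b - a) * integral {a..b} f\<bar>
        \<le> (b - a) / 2 * \<bar>f' (b / m)\<bar> powr m *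
          (2 * \<mu>\<^sub>1 ^ 3 / ((2 * \<mu>\<^sub>1 + 1) * (\<mu>\<^sub>1 + 1))
           + 2 * \<mu>\<^sub>2 ^ 3 / ((2 * \<mu>\<^sub>2 + 1) * (\<mu>\<^sub>2 + 1))
           + \<tau>\<^sub>1 + \<tau>\<^sub>2)"
      using est[OF _ _ _ _ J J] \<open>\<eta> = 1\<close> by simp
  next
    assume "\<eta> < 1"
    have J: "((\<lambda>t. ((\<eta> powr \<alpha>) powr (1 / \<tau>)) powr t) has_integral
        ((\<eta> powr (\<alpha> / \<tau>) - 1) / ln (\<eta> powr (\<alpha> / \<tau>)))) {0..1}" if "\<tau> > 0" for \<tau>
    proof -
      \<comment> \<open>The base of the exponential differs from 1, so its logarithm is a nonzero
        denominator.\<close>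
      have "\<eta> powr (\<alpha> / \<tau>) < 1"
        using \<open>\<eta> > 0\<close> \<open>\<eta> < 1\<close> \<open>0 < \<alpha>\<close> that by (simp add: powr01_less_one)
      then show ?thesis
        using has_integral_powr_base[of "\<eta> powr (\<alpha> / \<tau>)"] \<open>\<eta> > 0\<close> by (simp add: powr_powr)
    qed
    show "\<bar>(f a + f b) / 2 - 1 / (b - a) * integral {a..b} f\<bar>
        \<le> (b - a) / 2 * \<bar>f' (b / m)\<bar> powr m *
          (2 * \<mu>\<^sub>1 ^ 3 / ((2 * \<mu>\<^sub>1 + 1) * (\<mu>\<^sub>1 + 1))
           + 2 * \<mu>\<^sub>2 ^ 3 / ((2 * \<mu>\<^sub>2 + 1) * (\<mu>\<^sub>2 + 1))
           + \<tau>\<^sub>1 * ((\<eta> powr (\<alpha> / \<tau>\<^sub>1) - 1) / ln (\<eta> powr (\<alpha> / \<tau>\<^sub>1)))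
           + \<tau>\<^sub>2 * ((\<eta> powr (\<alpha> / \<tau>\<^sub>2) - 1) / ln (\<eta> powr (\<alpha> / \<tau>\<^sub>2))))"
      using \<open>\<eta> > 0\<close> \<open>\<eta> < 1\<close> by (intro est J assms(18,19)) auto
  qed
qed

end
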